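(* Let $q$ be a prime power, let $N\ge1$ and $r\ge1$ be integers, and let $\mathcal{B}=\mathcal{B}_1\cup\dots\cup\mathcal{B}_r$ be a cutting blocking set in $\mathrm{PG}(N,q)$. For each $i\in\{1,\dots,r\}$, let $\Gamma_i:=\langle\mathcal{B}_i\rangle\cong\mathrm{PG}(n_i,q)$ for some $n_i\le N$, and let $\mathcal{B}_i'\subseteq\Gamma_i$ be the isomorphic image of a cutting blocking set in $\mathrm{PG}(n_i,q)$. Then $\mathcal{B}':=\mathcal{B}_1'\cup\dots\cup\mathcal{B}_r'$ is a cutting blocking set in $\mathrm{PG}(N,q)$.
   Context: $\mathrm{PG}(N,q)$ is the $N$-dimensional projective space over $\mathbb{F}_q$ and $\langle\cdot\rangle$ denotes the projective span. A set $\mathcal{M}\subseteq\mathrm{PG}(N,q)$ ($N\ge1$) is a cutting blocking set if $\langle\mathcal{M}\cap H\rangle=H$ for every hyperplane $H$ of $\mathrm{PG}(N,q)$. In the degenerate case $N=0$, the only cutting blocking set of $\mathrm{PG}(0,q)$ is by convention the single point itself. "Isomorphic image" means the image under a projective isomorphism $\mathrm{PG}(n_i,q)\to\Gamma_i$. *)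

theory Defs
  imports "HOL-Library.Function_Algebras" "HOL-Library.Cardinality" "HOL-Number_Theory.Prime_Powers"
begin

text \<open>
  The dimension of the projective space varies inside the statement, so the coordinate space
  of dimension \<open>n + 1\<close> is realised as the subspace of those functions on \<open>nat\<close> that vanish
  outside \<open>{0..n}\<close>; all these spaces share one ambient vector space. A finite field with \<open>q\<close>
  elements is a type of class \<open>{field, finite}\<close> and cardinality \<open>q\<close>.
\<close>

definition fscale :: "'a::field \<Rightarrow> (nat \<Rightarrow> 'a) \<Rightarrow> nat \<Rightarrow> 'a" where
  "fscale c v = (\<lambda>i. c * v i)"

global_interpretation fvs: vector_space fscale
  by unfold_locales (auto simp: fscale_def fun_eq_iff algebra_simps)

definition coord_space :: "nat \<Rightarrow> (nat \<Rightarrow> 'a::field) set" where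
  "coord_space n = {v. \<forall>i>n. v i = 0}"

definition points_of :: "(nat \<Rightarrow> 'a::field) set \<Rightarrow> (nat \<Rightarrow> 'a) set set" where
  "points_of W = {P. fvs.subspace P \<and> fvs.dim P = 1 \<and> P \<subseteq> W}"

definition PG :: "nat \<Rightarrow> (nat \<Rightarrow> 'a::field) set set" where
  "PG n = points_of (coord_space n)"

text \<open>Projective subspaces are identified with their point sets; the empty one is included.\<close>

definition proj_subspace :: "nat \<Rightarrow> (nat \<Rightarrow> 'a::field) set set \<Rightarrow> bool" where
  "proj_subspace n S \<longleftrightarrow>
     (\<exists>W. fvs.subspace W \<and> W \<subseteq> coord_space n \<and> S = points_of W)"

text \<open>A hyperplane has projective dimension \<open>n - 1\<close>, hence vector space dimension \<open>n\<close>.\<close>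

definition hyperplane :: "nat \<Rightarrow> (nat \<Rightarrow> 'a::field) set set \<Rightarrow> bool" where
  "hyperplane n H \<longleftrightarrow>
     (\<exists>W. fvs.subspace W \<and> W \<subseteq> coord_space n \<and> fvs.dim W = n \<and> H = points_of W)"

definition proj_span :: "(nat \<Rightarrow> 'a::field) set set \<Rightarrow> (nat \<Rightarrow> 'a) set set" where
  "proj_span M = points_of (fvs.span (\<Union>M))"

text \<open>
  For \<open>n = 0\<close> the hyperplane condition would also admit the empty set, as the only hyperplane
  is empty; by convention the single point is then the only cutting blocking set.
\<close>

definition cutting_blocking_set :: "nat \<Rightarrow> (nat \<Rightarrow> 'a::field) set set \<Rightarrow> bool" where
  "cutting_blocking_set n M \<longleftrightarrow>
     (if n = 0 then M = PG 0
      else M \<subseteq> PG n \<and> (\<forall>H. hyperplane n H \<longrightarrow> proj_span (M \<inter> H) = H))"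

text \<open>
  Isomorphisms of projective spaces from \<open>PG n\<close> onto a subspace \<open>\<Gamma>\<close> of \<open>PG N\<close>: bijections
  between the points that preserve and reflect subspaces. Maps induced by linear or semilinear
  bijections of the underlying vector spaces are instances.
\<close>

definition proj_isomorphism ::
  "nat \<Rightarrow> nat \<Rightarrow> (nat \<Rightarrow> 'a::field) set set \<Rightarrow> ((nat \<Rightarrow> 'a) set \<Rightarrow> (nat \<Rightarrow> 'a) set) \<Rightarrow> bool" where
  "proj_isomorphism n N \<Gamma> \<phi> \<longleftrightarrow>
     proj_subspace N \<Gamma> \<and> bij_betw \<phi> (PG n) \<Gamma> \<and>
     (\<forall>S. S \<subseteq> PG n \<longrightarrow> (proj_subspace n S \<longleftrightarrow> proj_subspace N (\<phi> ` S)))"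

end

theory Submission
  imports Defs
begin

text \<open>
  It suffices to see that \<open>\<B>'\<^sub>i \<inter> H\<close> spans \<open>\<Gamma>\<^sub>i \<inter> H\<close> for every \<open>i\<close> and every hyperplane \<open>H\<close>,
  because \<open>\<B>\<^sub>i \<inter> H \<subseteq> \<Gamma>\<^sub>i \<inter> H\<close> and the sets \<open>\<B>\<^sub>i \<inter> H\<close> together span \<open>H\<close>. The set \<open>\<Gamma>\<^sub>i \<inter> H\<close> is
  either \<open>\<Gamma>\<^sub>i\<close> or a maximal proper subspace of it. Maximality is a property of the subspace
  lattice, so the preimage under the isomorphism is the whole space or a hyperplane, and a
  cutting blocking set of positive dimension spans either of them.
\<close>

section \<open>Bases and dimension of coordinate spaces\<close>

lemma subspace_coord_space: "fvs.subspace (coord_space n)"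
  by (auto simp: fvs.subspace_def coord_space_def fscale_def)

lemma span_subset_coord_space: "S \<subseteq> coord_space n \<Longrightarrow> fvs.span S \<subseteq> coord_space n"
  by (simp add: fvs.span_minimal subspace_coord_space)

text \<open>The ambient space of all functions is infinite-dimensional, so finiteness and dimension
  of subspaces are measured against this finite basis. The induction adjoins one unit vector at a
  time.\<close>

lemma basis_coord_space:
  "\<exists>B. finite B \<and> fvs.independent B \<and> fvs.span B = (coord_space n :: (nat \<Rightarrow> 'a::field) set)
     \<and> card B = Suc n"
proof (induction n)
  case 0
  define e :: "nat \<Rightarrow> 'a" where "e = (\<lambda>i. if i = 0 then 1 else 0)"
  have "e \<noteq> 0"
    by (auto simp: e_def fun_eq_iff)
  moreover have "fvs.span {e} = coord_space 0"
  proof (rule fvs.span_unique)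
    show "{e} \<subseteq> coord_space 0"
      by (auto simp: coord_space_def e_def)
    fix T assume "{e} \<subseteq> T" "fvs.subspace T"
    have "v = fscale (v 0) e" if "v \<in> coord_space 0" for v
      using that by (auto simp: fun_eq_iff fscale_def e_def coord_space_def)
    with \<open>{e} \<subseteq> T\<close> \<open>fvs.subspace T\<close> show "coord_space 0 \<subseteq> T"
      by (metis fvs.subspace_scale insert_subset subsetI)
  qed (rule subspace_coord_space)
  ultimately show ?case
    by (intro exI[of _ "{e}"]) auto
next
  case (Suc n)
  then obtain B where B: "finite B" "fvs.independent B"
    "fvs.span B = (coord_space n :: (nat \<Rightarrow> 'a) set)" "card B = Suc n"
    by blast
  define e :: "nat \<Rightarrow> 'a" where "e = (\<lambda>i. if i = Suc n then 1 else 0)"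
  have e: "e \<notin> fvs.span B"
    by (auto simp: B coord_space_def e_def)
  \<comment> \<open>The right-hand side is the membership condition that
    \<open>fvs.span_insert\<close> gives for the span of \<open>insert e B\<close>; the multiple to
    subtract is the last coordinate of \<open>x\<close>.\<close>
  have "x \<in> coord_space (Suc n) \<longleftrightarrow> (\<exists>k. x - fscale k e \<in> coord_space n)" for x
  proof
    assume "x \<in> coord_space (Suc n)"
    then have "x - fscale (x (Suc n)) e \<in> coord_space n"
      by (auto simp: coord_space_def fscale_def e_def)
    then show "\<exists>k. x - fscale k e \<in> coord_space n" ..
  next
    assume "\<exists>k. x - fscale k e \<in> coord_space n"
    then obtain k where k: "\<And>i. i > n \<Longrightarrow> x i - k * e i = 0"
      by (auto simp: coord_space_def fscale_def)
    show "x \<in> coord_space (Suc n)"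
      unfolding coord_space_def
    proof (intro CollectI allI impI)
      fix i assume "i > Suc n"
      then show "x i = 0"
        using k[of i] by (simp add: e_def)
    qed
  qed
  then have "fvs.span (insert e B) = coord_space (Suc n)"
    by (auto simp: fvs.span_insert B)
  moreover have "e \<notin> B"
    using e fvs.span_base by blast
  ultimately show ?case
    using B e by (intro exI[of _ "insert e B"]) (auto simp: fvs.independent_insert)
qed

lemma dim_coord_space: "fvs.dim (coord_space n :: (nat \<Rightarrow> 'a::field) set) = Suc n"
proof -
  obtain B where "fvs.independent B" "fvs.span B = (coord_space n :: (nat \<Rightarrow> 'a) set)"
      "card B = Suc n"
    using basis_coord_space by blast
  then show ?thesis
    using fvs.dim_span[of B] fvs.dim_eq_card_independent[of B] by simp
qed

text \<open>An independent subset of \<open>coord_space n\<close> is finite by the exchange bound,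
  so the cardinality of the basis is a genuine dimension and not the default value for infinite
  sets.\<close>

lemma finite_basis_in_coord_space:
  fixes W :: "(nat \<Rightarrow> 'a::field) set"
  assumes "fvs.subspace W" "W \<subseteq> coord_space n"
  obtains B where "finite B" "fvs.independent B" "fvs.span B = W" "card B = fvs.dim W" "B \<subseteq> W"
proof -
  obtain B where B: "B \<subseteq> W" "fvs.independent B" "W \<subseteq> fvs.span B" "card B = fvs.dim W"
    using fvs.basis_exists by blast
  obtain E where "finite E" "fvs.span E = (coord_space n :: (nat \<Rightarrow> 'a) set)"
    using basis_coord_space by blast
  then have "finite B"
    using fvs.independent_span_bound[of E B] B assms by auto
  moreover have "fvs.span B = W"
    using B assms(1) fvs.span_minimal by blast
  ultimately show thesis
    using that B by blast
qed

lemma dim_insert_coord_space: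
  fixes W :: "(nat \<Rightarrow> 'a::field) set"
  assumes "fvs.subspace W" "W \<subseteq> coord_space n" "v \<notin> W"
  shows "fvs.dim (fvs.span (insert v W)) = Suc (fvs.dim W)"
proof -
  obtain B where B: "finite B" "fvs.independent B" "fvs.span B = W" "card B = fvs.dim W" "B \<subseteq> W"
    using finite_basis_in_coord_space assms by blast
  then have "fvs.independent (insert v B)"
    using assms(3) by (simp add: fvs.independent_insertI)
  moreover have "fvs.span (insert v W) = fvs.span (insert v B)"
    by (simp add: fvs.span_insert B(3) fvs.span_eq_iff[THEN iffD2, OF assms(1)])
  moreover have "v \<notin> B"
    using B assms(3) by blast
  ultimately show ?thesis
    using B fvs.dim_eq_card_independent fvs.dim_span by (metis card_insert_disjoint)
qed

text \<open>A missing vector could be adjoined to \<open>W\<close>, giving \<open>n + 2\<close>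
  independent vectors in a space spanned by \<open>n + 1\<close>.\<close>

lemma subspace_eq_coord_space:
  fixes W :: "(nat \<Rightarrow> 'a::field) set"
  assumes W: "fvs.subspace W" "W \<subseteq> coord_space n" and "fvs.dim W = Suc n"
  shows "W = coord_space n"
proof (rule ccontr)
  assume "W \<noteq> coord_space n"
  then obtain v where v: "v \<in> coord_space n" "v \<notin> W"
    using W by blast
  have X: "fvs.span (insert v W) \<subseteq> coord_space n"
    using v W by (intro span_subset_coord_space) auto
  obtain B where B: "finite B" "fvs.independent B" "card B = Suc (Suc n)"
      "B \<subseteq> fvs.span (insert v W)"
    using finite_basis_in_coord_space[OF fvs.subspace_span X]
      dim_insert_coord_space[OF W v(2)] assms(3) by metis
  obtain E where E: "finite E" "fvs.span E = (coord_space n :: (nat \<Rightarrow> 'a) set)" "card E = Suc n"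
    using basis_coord_space by blast
  have "card B \<le> card E"
    using fvs.independent_span_bound[OF E(1) B(2)] B(4) X E(2) by auto
  with B(3) E(3) show False by simp
qed

text \<open>Trades the dimension in the definition of a hyperplane for a condition on subspaces
  alone. An isomorphism is only known to respect subspaces, so this is the form that can be carried
  across it.\<close>

lemma dim_eq_iff_span_insert:
  fixes W :: "(nat \<Rightarrow> 'a::field) set"
  assumes W: "fvs.subspace W" "W \<subseteq> coord_space n" and v: "v \<in> coord_space n" "v \<notin> W"
  shows "fvs.dim W = n \<longleftrightarrow> fvs.span (insert v W) = coord_space n"
proof -
  have "fvs.span (insert v W) \<subseteq> coord_space n"
    using v W by (intro span_subset_coord_space) auto
  then show ?thesis
    using subspace_eq_coord_space[OF fvs.subspace_span] dim_insert_coord_space[OF W v(2)]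
      dim_coord_space[of n, where 'a='a] by (metis nat.inject)
qed

section \<open>Points and projective spans\<close>

lemma point_generator:
  assumes "P \<in> points_of W"
  obtains u where "u \<in> W" "u \<noteq> 0" "P = fvs.span {u}"
proof -
  have P: "fvs.subspace P" "fvs.dim P = 1" "P \<subseteq> W"
    using assms by (auto simp: points_of_def)
  obtain B where B: "B \<subseteq> P" "fvs.independent B" "P \<subseteq> fvs.span B" "card B = fvs.dim P"
    using fvs.basis_exists by blast
  then obtain u where "B = {u}"
    using P card_1_singletonE by metis
  then show thesis
    using that[of u] B P fvs.span_minimal[of B P] by auto
qed

lemma span_singleton_in_points_of:
  assumes "fvs.subspace W" "u \<in> W" "u \<noteq> 0"
  shows "fvs.span {u} \<in> points_of W"
proof -
  have "fvs.dim {u} = 1"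
    using assms(3) fvs.dim_eq_card_independent[of "{u}"] by simp
  moreover have "fvs.span {u} \<subseteq> W"
    using assms(1,2) by (intro fvs.span_minimal) auto
  ultimately show ?thesis
    by (simp add: points_of_def fvs.dim_span)
qed

lemma points_of_Int: "points_of (V \<inter> W) = points_of V \<inter> points_of W"
  by (auto simp: points_of_def)

text \<open>Every nonzero vector spans a point, so a subspace can be recovered from its points; this
  allows passing freely between vectors and point sets.\<close>

lemma points_of_subset_iff:
  assumes "fvs.subspace V" "fvs.subspace W"
  shows "points_of V \<subseteq> points_of W \<longleftrightarrow> V \<subseteq> W"
proof
  assume *: "points_of V \<subseteq> points_of W"
  show "V \<subseteq> W"
  proof
    fix u assume u: "u \<in> V"
    show "u \<in> W"
    proof (cases "u = 0")
      case True
      then show ?thesis using assms(2) fvs.subspace_0 by blast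
    next
      case False
      then have "fvs.span {u} \<in> points_of W"
        using * u assms(1) span_singleton_in_points_of by blast
      then show ?thesis
        using fvs.span_base[of u "{u}"] by (auto simp: points_of_def)
    qed
  qed
qed (auto simp: points_of_def)

lemma subset_proj_span: "M \<subseteq> points_of W \<Longrightarrow> M \<subseteq> proj_span M"
  by (auto simp: proj_span_def points_of_def intro: fvs.span_base)

lemma proj_span_minimal: "fvs.subspace W \<Longrightarrow> M \<subseteq> points_of W \<Longrightarrow> proj_span M \<subseteq> points_of W"
proof -
  assume "fvs.subspace W" "M \<subseteq> points_of W"
  then have "fvs.span (\<Union>M) \<subseteq> W"
    by (intro fvs.span_minimal) (auto simp: points_of_def)
  then show ?thesis
    by (auto simp: proj_span_def points_of_def)
qed

lemma proj_span_mono: "M \<subseteq> M' \<Longrightarrow> proj_span M \<subseteq> proj_span M'"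
proof -
  assume "M \<subseteq> M'"
  then have "fvs.span (\<Union>M) \<subseteq> fvs.span (\<Union>M')"
    by (intro fvs.span_mono Union_mono)
  then show ?thesis
    by (auto simp: proj_span_def points_of_def)
qed

section \<open>Cutting blocking sets and their hyperplane sections\<close>

lemma cutting_blocking_set_subset: "cutting_blocking_set n M \<Longrightarrow> M \<subseteq> PG n"
  by (auto simp: cutting_blocking_set_def split: if_splits)

text \<open>The hyperplanes \<open>x\<^sub>0 = 0\<close> and \<open>x\<^sub>n = 0\<close> already generate the whole space.\<close>

lemma proj_span_cutting_blocking_set:
  fixes C :: "(nat \<Rightarrow> 'a::field) set set"
  assumes C: "cutting_blocking_set n C" and n: "n > 0"
  shows "proj_span C = PG n"
proof
  show "proj_span C \<subseteq> PG n"
    using proj_span_minimal[OF subspace_coord_space] cutting_blocking_set_subset[OF C]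
    by (simp add: PG_def)
  define Z :: "nat \<Rightarrow> (nat \<Rightarrow> 'a) set" where "Z j = {v \<in> coord_space n. v j = 0}" for j
  define e :: "nat \<Rightarrow> nat \<Rightarrow> 'a" where "e j = (\<lambda>i. if i = j then 1 else 0)" for j
  have Z: "fvs.subspace (Z j)" "Z j \<subseteq> coord_space n" for j
    by (auto simp: Z_def coord_space_def fvs.subspace_def fscale_def)
  have e: "e j \<in> coord_space n" "e j \<notin> Z j" if "j \<le> n" for j
    using that by (auto simp: e_def coord_space_def Z_def)
  have decomp: "x - fscale (x j) (e j) \<in> Z j" if "x \<in> coord_space n" "j \<le> n" for x j
    using that by (auto simp: Z_def e_def coord_space_def fscale_def)
  \<comment> \<open>Adjoining \<open>e j\<close> to \<open>Z j\<close> fills the space, so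
    \<open>Z j\<close> is a hyperplane and the cutting property applies to it.\<close>
  have Z_le: "Z j \<subseteq> fvs.span (\<Union>C)" if "j \<le> n" for j
  proof -
    have "fvs.span (insert (e j) (Z j)) \<subseteq> coord_space n"
      using e that Z by (intro span_subset_coord_space) auto
    moreover have "coord_space n \<subseteq> fvs.span (insert (e j) (Z j))"
      using decomp[OF _ that] by (auto simp: fvs.span_insert intro: fvs.span_base)
    ultimately have "fvs.dim (Z j) = n"
      using dim_eq_iff_span_insert[OF Z e[OF that]] by auto
    then have "hyperplane n (points_of (Z j))"
      using Z by (auto simp: hyperplane_def)
    then have "proj_span (C \<inter> points_of (Z j)) = points_of (Z j)"
      using C n by (simp add: cutting_blocking_set_def)
    then have "points_of (Z j) \<subseteq> proj_span C"
      using proj_span_mono[of "C \<inter> points_of (Z j)" C] by auto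
    then show ?thesis
      unfolding proj_span_def using points_of_subset_iff[OF Z(1) fvs.subspace_span] by blast
  qed
  have "coord_space n \<subseteq> fvs.span (\<Union>C)"
  proof
    fix x :: "nat \<Rightarrow> 'a" assume x: "x \<in> coord_space n"
    \<comment> \<open>Here \<open>n > 0\<close> matters: the two hyperplanes differ, so
      \<open>x\<close> splits into a multiple of \<open>e 0\<close>, lying in \<open>Z n\<close>,
      and a remainder in \<open>Z 0\<close>.\<close>
    have "e 0 \<in> Z n"
      using n by (auto simp: Z_def e_def coord_space_def)
    then have "fscale (x 0) (e 0) \<in> fvs.span (\<Union>C)"
      using Z_le[of n] fvs.span_scale by blast
    moreover have "x - fscale (x 0) (e 0) \<in> fvs.span (\<Union>C)"
      using Z_le[of 0] decomp[OF x, of 0] by blast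
    ultimately show "x \<in> fvs.span (\<Union>C)"
      using fvs.span_add by fastforce
  qed
  then show "PG n \<subseteq> proj_span C"
    unfolding PG_def proj_span_def by (auto simp: points_of_def)
qed

text \<open>If \<open>S\<close> misses a point \<open>P\<close>, the subspace generated by
  \<open>S\<close> and \<open>P\<close> is mapped to a subspace properly containing the section of
  \<open>\<Gamma>\<close> by \<open>H\<close>. That section has codimension at most one in
  \<open>\<Gamma>\<close>, so the image is all of \<open>\<Gamma>\<close>. Hence \<open>S\<close>
  together with any such \<open>P\<close> generates the whole space, which makes \<open>S\<close> a
  hyperplane.\<close>

lemma hyperplane_section_preimage:
  fixes \<phi> :: "(nat \<Rightarrow> 'a::field) set \<Rightarrow> (nat \<Rightarrow> 'a) set"
  assumes iso: "proj_isomorphism n N \<Gamma> \<phi>" and H: "hyperplane N H"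
    and S: "S \<subseteq> PG n" "\<phi> ` S = \<Gamma> \<inter> H"
  shows "S = PG n \<or> hyperplane n S"
proof (rule disjCI)
  assume nh: "\<not> hyperplane n S"
  obtain V where V: "fvs.subspace V" "V \<subseteq> coord_space N" "\<Gamma> = points_of V"
    using iso by (auto simp: proj_isomorphism_def proj_subspace_def)
  obtain W where W: "fvs.subspace W" "W \<subseteq> coord_space N" "fvs.dim W = N" "H = points_of W"
    using H by (auto simp: hyperplane_def)
  have bij: "bij_betw \<phi> (PG n) \<Gamma>"
    and sub: "\<And>T. T \<subseteq> PG n \<Longrightarrow> proj_subspace n T \<longleftrightarrow> proj_subspace N (\<phi> ` T)"
    using iso by (auto simp: proj_isomorphism_def)
  have inj: "inj_on \<phi> (PG n)" and img: "\<phi> ` PG n = \<Gamma>"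
    using bij by (auto simp: bij_betw_def)
  have "proj_subspace N (\<Gamma> \<inter> H)"
    unfolding proj_subspace_def V(3) W(4) points_of_Int[symmetric]
    using fvs.subspace_inter[OF V(1) W(1)] V(2) by blast
  then obtain U where U: "fvs.subspace U" "U \<subseteq> coord_space n" "S = points_of U"
    using sub[OF S(1)] S(2) by (auto simp: proj_subspace_def)
  show "S = PG n"
  proof (rule ccontr)
    assume "S \<noteq> PG n"
    then obtain P where P: "P \<in> PG n" "P \<notin> S"
      using S(1) by blast
    then obtain u where u: "u \<in> coord_space n" "u \<noteq> 0" "P = fvs.span {u}"
      unfolding PG_def by (blast elim: point_generator)
    have uU: "u \<notin> U"
      using P(2) u U span_singleton_in_points_of by blast
    let ?X = "fvs.span (insert u U)"
    have X: "?X \<subseteq> coord_space n"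
      using u U by (intro span_subset_coord_space) auto
    have XPG: "points_of ?X \<subseteq> PG n"
      using X by (auto simp: PG_def points_of_def)
    have "proj_subspace n (points_of ?X)"
      using X by (auto simp: proj_subspace_def)
    then obtain Y where Y: "fvs.subspace Y" "\<phi> ` points_of ?X = points_of Y"
      using sub[OF XPG] by (auto simp: proj_subspace_def)
    have "S \<subseteq> points_of ?X"
      using U points_of_subset_iff[OF U(1) fvs.subspace_span] by (auto intro: fvs.span_base)
    then have "points_of (V \<inter> W) \<subseteq> points_of Y"
      unfolding points_of_Int V(3)[symmetric] W(4)[symmetric] S(2)[symmetric] Y(2)[symmetric]
      by (rule image_mono)
    then have VWY: "V \<inter> W \<subseteq> Y"
      using points_of_subset_iff[OF fvs.subspace_inter[OF V(1) W(1)] Y(1)] by blast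
    have "P \<in> points_of ?X"
      using u by (auto intro!: span_singleton_in_points_of intro: fvs.span_base)
    then have QY: "\<phi> P \<in> points_of Y"
      using Y(2) by blast
    have QV: "\<phi> P \<in> points_of V"
      using P img V by blast
    have "\<phi> P \<notin> H"
    proof
      assume "\<phi> P \<in> H"
      then have "\<phi> P \<in> \<phi> ` S"
        using QV S(2) V(3) by blast
      then show False
        using inj P S(1) inj_on_image_mem_iff by metis
    qed
    \<comment> \<open>\<open>w\<close> witnesses that the image of \<open>P\<close> leaves the
      hyperplane; since \<open>W\<close> has codimension one, \<open>w\<close> and \<open>W\<close>
      generate everything.\<close>
    then obtain w where w: "w \<in> \<phi> P" "w \<notin> W"
      using QV W(4) by (auto simp: points_of_def)
    have wV: "w \<in> V" and wY: "w \<in> Y"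
      using w QV QY by (auto simp: points_of_def)
    have full: "fvs.span (insert w W) = coord_space N"
      using dim_eq_iff_span_insert W w wV V by blast
    have "V \<subseteq> Y"
    proof
      fix x assume x: "x \<in> V"
      \<comment> \<open>Modulo \<open>W\<close>, each \<open>x\<close> in \<open>V\<close> is a
        multiple of \<open>w\<close>. As \<open>x\<close> and \<open>w\<close> both lie in
        \<open>V\<close>, the difference lies in \<open>V \<inter> W\<close> and therefore in
        \<open>Y\<close>.\<close>
      then obtain k where "x - fscale k w \<in> W"
        using full V W(1) by (auto simp: fvs.span_insert fvs.span_eq_iff[THEN iffD2, OF W(1)])
      moreover have "x - fscale k w \<in> V"
        using x wV V(1) fvs.subspace_diff fvs.subspace_scale by blast
      ultimately have "x - fscale k w \<in> Y"
        using VWY by blast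
      then show "x \<in> Y"
        using wY Y(1) fvs.subspace_add[of Y "x - fscale k w" "fscale k w"] fvs.subspace_scale
        by fastforce
    qed
    \<comment> \<open>The subspace \<open>?X\<close> already has the full image
      \<open>\<Gamma>\<close>, so injectivity forces it to contain every point of
      \<open>PG n\<close>.\<close>
    then have "\<phi> ` PG n \<subseteq> \<phi> ` points_of ?X"
      using points_of_subset_iff[OF V(1) Y(1)] by (simp add: img V(3) Y(2))
    then have "\<phi> ` PG n = \<phi> ` points_of ?X"
      using image_mono[OF XPG] by (rule equalityI)
    then have "PG n \<subseteq> points_of ?X"
      using inj_on_image_eq_iff[OF inj order_refl XPG] by simp
    then have "?X = coord_space n"
      using X points_of_subset_iff[OF subspace_coord_space fvs.subspace_span]
      unfolding PG_def by blast
    then have "fvs.dim U = n"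
      using dim_eq_iff_span_insert[OF U(1,2) u(1) uU] by blast
    with nh U show False
      by (auto simp: hyperplane_def)
  qed
qed

text \<open>The preimage of the section is spanned by its points in \<open>C\<close>. Pulling the
  span on the right back along the isomorphism gives a subspace containing those points, hence the
  whole preimage.\<close>

lemma hyperplane_section_spanned:
  fixes \<phi> :: "(nat \<Rightarrow> 'a::field) set \<Rightarrow> (nat \<Rightarrow> 'a) set"
  assumes iso: "proj_isomorphism n N \<Gamma> \<phi>" and C: "cutting_blocking_set n C"
    and H: "hyperplane N H"
  shows "\<Gamma> \<inter> H \<subseteq> proj_span (\<phi> ` C \<inter> H)"
proof -
  obtain V where V: "fvs.subspace V" "V \<subseteq> coord_space N" "\<Gamma> = points_of V"
    using iso by (auto simp: proj_isomorphism_def proj_subspace_def)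
  obtain W where W: "fvs.subspace W" "H = points_of W"
    using H by (auto simp: hyperplane_def)
  have inj: "inj_on \<phi> (PG n)" and img: "\<phi> ` PG n = \<Gamma>"
    and sub: "\<And>T. T \<subseteq> PG n \<Longrightarrow> proj_subspace n T \<longleftrightarrow> proj_subspace N (\<phi> ` T)"
    using iso by (auto simp: proj_isomorphism_def bij_betw_def)
  have CPG: "C \<subseteq> PG n"
    using C by (rule cutting_blocking_set_subset)
  have CH: "\<phi> ` C \<inter> H \<subseteq> points_of (V \<inter> W)"
    using CPG img by (auto simp: points_of_Int V W)
  show ?thesis
  proof (cases "n = 0")
    \<comment> \<open>The convention for dimension 0 makes \<open>C\<close> the whole of
      \<open>PG 0\<close>, so its image is all of \<open>\<Gamma>\<close>.\<close>
    case True
    then have "\<phi> ` C = \<Gamma>"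
      using C img by (simp add: cutting_blocking_set_def)
    then show ?thesis
      using CH subset_proj_span by blast
  next
    case False
    define S where "S = {P \<in> PG n. \<phi> P \<in> H}"
    have S: "S \<subseteq> PG n" "\<phi> ` S = \<Gamma> \<inter> H"
      using img by (auto simp: S_def)
    have "C \<inter> PG n = C"
      using CPG by blast
    \<comment> \<open>When \<open>\<Gamma>\<close> lies inside \<open>H\<close>, \<open>S\<close> is
      the whole space and no hyperplane of \<open>PG n\<close>; \<open>C\<close> spans it because
      \<open>n\<close> is positive. Otherwise the cutting property applies directly.\<close>
    then have span: "proj_span (C \<inter> S) = S"
    proof (cases "S = PG n")
      case True
      then show ?thesis
        using proj_span_cutting_blocking_set[OF C] False \<open>C \<inter> PG n = C\<close> by simp
    next
      case False
      then show ?thesis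
        using hyperplane_section_preimage[OF iso H S] C \<open>n \<noteq> 0\<close>
        by (simp add: cutting_blocking_set_def)
    qed
    let ?T = "proj_span (\<phi> ` C \<inter> H)"
    have TV: "?T \<subseteq> points_of (V \<inter> W)"
      using proj_span_minimal[OF fvs.subspace_inter[OF V(1) W(1)] CH] .
    \<comment> \<open>\<open>R\<close> is the pullback of \<open>?T\<close>. Once \<open>?T\<close>
      is seen to be a subspace of \<open>PG N\<close>, reflection of subspaces makes
      \<open>R\<close> a subspace.\<close>
    define R where "R = {P \<in> PG n. \<phi> P \<in> ?T}"
    have "?T \<subseteq> \<phi> ` PG n"
      using TV by (simp add: img V(3) points_of_Int)
    then have R: "R \<subseteq> PG n" "\<phi> ` R = ?T"
      unfolding R_def by blast+
    have "?T \<subseteq> points_of (coord_space N)"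
      using TV V(2) by (auto simp: points_of_def)
    then have "fvs.span (\<Union>(\<phi> ` C \<inter> H)) \<subseteq> coord_space N"
      unfolding proj_span_def
      using points_of_subset_iff[OF fvs.subspace_span subspace_coord_space] by blast
    then have "proj_subspace N ?T"
      unfolding proj_subspace_def proj_span_def by (blast intro: fvs.subspace_span)
    then obtain U where U: "fvs.subspace U" "R = points_of U"
      using sub[OF R(1)] R(2) by (auto simp: proj_subspace_def)
    have "C \<inter> S \<subseteq> R"
      using CPG subset_proj_span[OF CH] by (auto simp: S_def R_def)
    then have "S \<subseteq> R"
      using proj_span_minimal U span by metis
    then show ?thesis
      using S(2) R(2) by blast
  qed
qed

section \<open>Replacement of the pieces of a cutting blocking set\<close>

theorem proposition4p5:
  fixes q N r :: nat
    and \<B> \<B>' :: "(nat \<Rightarrow> 'a::{field,finite}) set set"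
    and Bs \<Gamma> Bs' :: "nat \<Rightarrow> (nat \<Rightarrow> 'a) set set"
    and n :: "nat \<Rightarrow> nat"
  assumes "primepow q" and "CARD('a) = q"
    and "N \<ge> 1" and "r \<ge> 1"
    and "\<B> = (\<Union>i\<in>{1..r}. Bs i)"
    and "cutting_blocking_set N \<B>"
    and "\<And>i. i \<in> {1..r} \<Longrightarrow> \<Gamma> i = proj_span (Bs i)"
    and "\<And>i. i \<in> {1..r} \<Longrightarrow> n i \<le> N"
    and "\<And>i. i \<in> {1..r} \<Longrightarrow>
           \<exists>\<phi> C. proj_isomorphism (n i) N (\<Gamma> i) \<phi> \<and> cutting_blocking_set (n i) C \<and> Bs' i = \<phi> ` C"
    and "\<B>' = (\<Union>i\<in>{1..r}. Bs' i)"
  shows "cutting_blocking_set N \<B>'"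
proof -
  have Bs'_PG: "Bs' i \<subseteq> PG N" if i: "i \<in> {1..r}" for i
  proof -
    obtain \<phi> C where \<phi>: "proj_isomorphism (n i) N (\<Gamma> i) \<phi>"
      and C: "cutting_blocking_set (n i) C" "Bs' i = \<phi> ` C"
      using assms(9)[OF i] by blast
    have "\<phi> ` PG (n i) = \<Gamma> i"
      using \<phi> by (auto simp: proj_isomorphism_def bij_betw_def)
    then have "Bs' i \<subseteq> \<Gamma> i"
      using image_mono[OF cutting_blocking_set_subset[OF C(1)], of \<phi>] C(2) by simp
    moreover have "proj_subspace N (\<Gamma> i)"
      using \<phi> by (simp add: proj_isomorphism_def)
    then have "\<Gamma> i \<subseteq> PG N"
      by (auto simp: proj_subspace_def PG_def points_of_def)
    ultimately show ?thesis by blast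
  qed
  have "proj_span (\<B>' \<inter> H) = H" if H: "hyperplane N H" for H
  proof
    obtain W where W: "fvs.subspace W" "H = points_of W"
      using H by (auto simp: hyperplane_def)
    show "proj_span (\<B>' \<inter> H) \<subseteq> H"
      unfolding W(2) by (rule proj_span_minimal) (auto simp: W)
    \<comment> \<open>Each old piece is covered through its own span: its points in \<open>H\<close>
      lie in the section of \<open>\<Gamma> i\<close>, which the new piece spans.\<close>
    have "Bs i \<inter> H \<subseteq> proj_span (\<B>' \<inter> H)" if i: "i \<in> {1..r}" for i
    proof -
      have "Bs i \<subseteq> points_of (coord_space N)"
        using cutting_blocking_set_subset[OF assms(6)] i unfolding assms(5) PG_def by blast
      then have "Bs i \<inter> H \<subseteq> \<Gamma> i \<inter> H"
        using subset_proj_span assms(7)[OF i] by blast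
      also have "\<dots> \<subseteq> proj_span (Bs' i \<inter> H)"
      proof -
        obtain \<phi> C where "proj_isomorphism (n i) N (\<Gamma> i) \<phi>" "cutting_blocking_set (n i) C"
          "Bs' i = \<phi> ` C"
          using assms(9)[OF i] by blast
        then show ?thesis
          using hyperplane_section_spanned[OF _ _ H] by metis
      qed
      also have "\<dots> \<subseteq> proj_span (\<B>' \<inter> H)"
        using i assms(10) by (intro proj_span_mono) auto
      finally show ?thesis .
    qed
    \<comment> \<open>The old pieces jointly span \<open>H\<close> by the cutting property of
      \<open>\<B>\<close>, so a subspace containing all of them in \<open>H\<close> contains
      \<open>H\<close>.\<close>
    then have "\<B> \<inter> H \<subseteq> points_of (fvs.span (\<Union>(\<B>' \<inter> H)))"
      unfolding assms(5) proj_span_def by blast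
    then have "proj_span (\<B> \<inter> H) \<subseteq> proj_span (\<B>' \<inter> H)"
      using proj_span_minimal[OF fvs.subspace_span] by (simp add: proj_span_def)
    moreover have "proj_span (\<B> \<inter> H) = H"
      using assms(3,6) H by (simp add: cutting_blocking_set_def)
    ultimately show "H \<subseteq> proj_span (\<B>' \<inter> H)" by simp
  qed
  moreover have "\<B>' \<subseteq> PG N"
    using Bs'_PG assms(10) by blast
  ultimately show ?thesis
    using assms(3) by (simp add: cutting_blocking_set_def)
qed

end
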